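(* Let $(Z_n)_{n\in\mathbb N}\subset L^2(\Omega,\mathcal A,\mathbb P)$ be such that $\mathbb E_\infty(Z_n)=0$ for every $n\in\mathbb N$. Suppose that $$\sum_{k=0}^\infty\Big(\sum_{n=0}^\infty\|\mathfrak d_{n+k}Z_n\|_2^2\Big)^{1/2}<\infty\qquad\text{and}\qquad \sum_{k=1}^\infty\Big(\sum_{n=0}^\infty\|\mathfrak d_nZ_{n+k}\|_2^2\Big)^{1/2}<\infty .$$ Then the series $\sum_{n\in\mathbb N}Z_n$ converges $\mathbb P$-almost surely and in $L^2(\Omega,\mathcal A,\mathbb P)$.
   Context: $\mathbb N=\{0,1,2,\dots\}$. $(\Omega,\mathcal A,\mathbb P)$ is a probability space and $(\mathcal B_n)_{n\in\mathbb N}$ is a decreasing sequence of sub-$\sigma$-algebras of $\mathcal A$ with $\mathcal B_0=\mathcal A$; $\mathcal B_\infty:=\bigcap_{n\ge 0}\mathcal B_n$. For $n\in\mathbb N\cup\{\infty\}$ write $\mathbb E_n:=\mathbb E(\cdot\,|\,\mathcal B_n)$, and for $n\in\mathbb N$ write $\mathfrak d_n:=\mathbb E_n-\mathbb E_{n+1}$. $\|\cdot\|_2$ is the norm of $L^2(\Omega,\mathcal A,\mathbb P)$. *)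

theory Defs
  imports "HOL-Probability.Probability"
begin

definition L2_space :: "'a measure \<Rightarrow> ('a \<Rightarrow> real) set" where
  "L2_space M = {f \<in> borel_measurable M. integrable M (\<lambda>x. (f x)\<^sup>2)}"

(* The norm of L^2(M); meaningful on L2_space M only, since a Bochner integral
   that does not exist is 0. *)
definition L2_norm :: "'a measure \<Rightarrow> ('a \<Rightarrow> real) \<Rightarrow> real" where
  "L2_norm M f = sqrt (\<integral>x. (f x)\<^sup>2 \<partial>M)"

(* A sub-sigma-algebra of M is represented by a measure F with subalgebra M F. Only space F
   and sets F matter: conditional expectations are always taken with respect to the measure M.
   The sigma-closure below adds nothing, see sets_tail_algebra. *)
definition tail_algebra :: "'a measure \<Rightarrow> (nat \<Rightarrow> 'a measure) \<Rightarrow> 'a measure" where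
  "tail_algebra M B = sigma (space M) (\<Inter>n. sets (B n))"

lemma sets_tail_algebra:
  assumes "\<And>n. subalgebra M (B n)"
  shows "sets (tail_algebra M B) = (\<Inter>n. sets (B n))"
proof -
  have sp: "space (B n) = space M" for n
    using assms[of n] by (simp add: subalgebra_def)
  have "sigma_algebra (space M) (\<Inter>n. sets (B n))"
    unfolding sigma_algebra_iff2
  proof (intro conjI ballI allI impI)
    show "(\<Inter>n. sets (B n)) \<subseteq> Pow (space M)"
      using sets.sets_into_space[of _ "B 0"] sp by blast
    show "{} \<in> (\<Inter>n. sets (B n))"
      by simp
    show "space M - A \<in> (\<Inter>n. sets (B n))" if "A \<in> (\<Inter>n. sets (B n))" for A
      using that sets.compl_sets[of A] sp by (metis INT_iff)
    show "(\<Union>i. A i) \<in> (\<Inter>n. sets (B n))"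
      if "range A \<subseteq> (\<Inter>n. sets (B n))" for A :: "nat \<Rightarrow> 'a set"
      using that by (intro INT_I sets.countable_nat_UN) blast
  qed
  then show ?thesis
    unfolding tail_algebra_def by (rule sigma_algebra.sets_measure_of_eq)
qed

lemma subalgebra_tail_algebra:
  assumes "\<And>n. subalgebra M (B n)"
  shows "subalgebra M (tail_algebra M B)"
proof -
  have "sets (B 0) \<subseteq> sets M"
    using assms[of 0] by (simp add: subalgebra_def)
  then show ?thesis
    unfolding subalgebra_def sets_tail_algebra[OF assms]
    by (auto simp: tail_algebra_def space_measure_of_conv)
qed

definition cond_exp_diff ::
  "'a measure \<Rightarrow> (nat \<Rightarrow> 'a measure) \<Rightarrow> nat \<Rightarrow> ('a \<Rightarrow> real) \<Rightarrow> 'a \<Rightarrow> real" where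
  "cond_exp_diff M B n f =
    (\<lambda>x. real_cond_exp M (B n) f x - real_cond_exp M (B (Suc n)) f x)"

end

theory Submission
  imports Defs
begin

text \<open>
Because the tail expectation of \<open>Z j\<close> vanishes, reverse martingale convergence gives
\<open>Z j = (\<Sum>m. d m (Z j))\<close> almost everywhere, where \<open>d m\<close> is the difference of the conditional
expectations at \<open>m\<close> and \<open>Suc m\<close> (\<open>sums_cond_exp_diff\<close>). The partial sums of \<open>Z\<close> are then rearranged
along the diagonals of the array \<open>d m (Z j)\<close> (\<open>sum_rearrange\<close>). The two hypotheses on sums of norms
concern exactly the diagonals \<open>m - j = k\<close> and \<open>j - m = k\<close>.

The point of this rearrangement is that each diagonal is a sequence of reverse martingale
differences. Doob's inequality (\<open>Doob_maximal\<close>) therefore bounds the expected maximum of its partial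
sums by four times \<open>\<sigma> k\<close>, the square root of the sum of its squared norms. It shows two things.
Every single diagonal has a convergent sum almost everywhere (\<open>AE_summable\<close>). And since the \<open>\<sigma> k\<close>
are summable, the maximal functions of all diagonals have a finite sum almost everywhere
(\<open>AE_dominated\<close>), so that dominated convergence for series allows the limit to be taken inside the
sum over the diagonals (\<open>double_sum_AE\<close>).

For convergence in \<open>L\<^sup>2\<close> the remainder is estimated by the sum over \<open>k\<close> of the tail norms of the
diagonals. These tails are at most \<open>\<sigma> k\<close> and each of them tends to 0, so dominated convergence
applies a second time (\<open>double_sum_remainder\<close>).
\<close>

section \<open>Square-integrable functions\<close>

lemma L2_spaceD:
  assumes "f \<in> L2_space M"
  shows "f \<in> borel_measurable M" "integrable M (\<lambda>x. (f x)\<^sup>2)"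
  using assms by (auto simp: L2_space_def)

lemma L2_mult_integrable:
  assumes f: "f \<in> L2_space M" and g: "g \<in> L2_space M"
  shows "integrable M (\<lambda>x. f x * g x)"
proof (rule Bochner_Integration.integrable_bound)
  show "integrable M (\<lambda>x. (f x)\<^sup>2 + (g x)\<^sup>2)"
    using L2_spaceD[OF f] L2_spaceD[OF g] by simp
  show "(\<lambda>x. f x * g x) \<in> borel_measurable M"
    using L2_spaceD[OF f] L2_spaceD[OF g] by simp
  have "\<bar>a * b\<bar> \<le> a\<^sup>2 + b\<^sup>2" for a b :: real
  proof -
    have "2 * (\<bar>a\<bar> * \<bar>b\<bar>) \<le> a\<^sup>2 + b\<^sup>2"
      using sum_squares_bound[of "\<bar>a\<bar>" "\<bar>b\<bar>"] by simp
    moreover have "0 \<le> \<bar>a\<bar> * \<bar>b\<bar>"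
      by simp
    ultimately show ?thesis
      unfolding abs_mult by linarith
  qed
  then show "AE x in M. norm (f x * g x) \<le> norm ((f x)\<^sup>2 + (g x)\<^sup>2)"
    by simp
qed

lemma L2_zero: "(\<lambda>x. 0) \<in> L2_space M"
  by (simp add: L2_space_def)

lemma L2_cmult:
  assumes "f \<in> L2_space M"
  shows "(\<lambda>x. c * f x) \<in> L2_space M"
  using L2_spaceD[OF assms] by (simp add: L2_space_def power_mult_distrib)

lemma L2_uminus:
  assumes "f \<in> L2_space M"
  shows "(\<lambda>x. - f x) \<in> L2_space M"
  using L2_spaceD[OF assms] by (simp add: L2_space_def)

lemma L2_add:
  assumes f: "f \<in> L2_space M" and g: "g \<in> L2_space M"
  shows "(\<lambda>x. f x + g x) \<in> L2_space M"
  using L2_spaceD[OF f] L2_spaceD[OF g] L2_mult_integrable[OF f g]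
  by (simp add: L2_space_def power2_sum mult.assoc)

lemma L2_diff:
  assumes f: "f \<in> L2_space M" and g: "g \<in> L2_space M"
  shows "(\<lambda>x. f x - g x) \<in> L2_space M"
  using L2_add[OF f L2_uminus[OF g]] by simp

lemma L2_sum:
  assumes "\<And>i. i \<in> I \<Longrightarrow> f i \<in> L2_space M"
  shows "(\<lambda>x. \<Sum>i\<in>I. f i x) \<in> L2_space M"
  using assms
  by (induction I rule: infinite_finite_induct) (auto simp: L2_zero intro: L2_add)

lemma L2_max:
  assumes f: "f \<in> L2_space M" and g: "g \<in> L2_space M"
  shows "(\<lambda>x. max (f x) (g x)) \<in> L2_space M"
proof -
  have [measurable]: "f \<in> borel_measurable M" "g \<in> borel_measurable M"
    using L2_spaceD(1) f g by auto
  have "integrable M (\<lambda>x. (max (f x) (g x))\<^sup>2)"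
  proof (rule Bochner_Integration.integrable_bound)
    show "integrable M (\<lambda>x. (f x)\<^sup>2 + (g x)\<^sup>2)"
      using L2_spaceD[OF f] L2_spaceD[OF g] by simp
  qed (auto simp: max_def)
  then show ?thesis
    by (simp add: L2_space_def)
qed

lemma L2_norm_nonneg: "0 \<le> L2_norm M f"
  by (simp add: L2_norm_def)

lemma L2_norm_square: "(L2_norm M f)\<^sup>2 = (\<integral>x. (f x)\<^sup>2 \<partial>M)"
  by (simp add: L2_norm_def)

lemma L2_norm_uminus: "L2_norm M (\<lambda>x. - f x) = L2_norm M f"
  by (simp add: L2_norm_def)

lemma L2_cong_AE:
  assumes "f \<in> L2_space M" "g \<in> borel_measurable M" "AE x in M. f x = g x"
  shows "g \<in> L2_space M" "L2_norm M g = L2_norm M f"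
proof -
  have [measurable]: "f \<in> borel_measurable M" "g \<in> borel_measurable M"
    using L2_spaceD(1) assms by auto
  have "integrable M (\<lambda>x. (g x)\<^sup>2) \<longleftrightarrow> integrable M (\<lambda>x. (f x)\<^sup>2)"
    using assms(3) by (intro integrable_cong_AE) auto
  then show "g \<in> L2_space M"
    using L2_spaceD[OF assms(1)] assms(2) by (simp add: L2_space_def)
  show "L2_norm M g = L2_norm M f"
    unfolding L2_norm_def using assms(3) by (intro arg_cong[of _ _ sqrt] integral_cong_AE) auto
qed

lemma L2_Cauchy_Schwarz:
  assumes f: "f \<in> L2_space M" and g: "g \<in> L2_space M"
  shows "(\<integral>x. f x * g x \<partial>M) \<le> L2_norm M f * L2_norm M g"
proof -
  let ?a = "L2_norm M f" and ?b = "L2_norm M g" and ?I = "\<integral>x. f x * g x \<partial>M"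
  have q: "2 * s * t * ?I \<le> s\<^sup>2 * ?a\<^sup>2 + t\<^sup>2 * ?b\<^sup>2" for s t :: real
  proof -
    have "0 \<le> (\<integral>x. (s * f x - t * g x)\<^sup>2 \<partial>M)"
      by simp
    also have "\<dots> = (\<integral>x. s\<^sup>2 * (f x)\<^sup>2 + t\<^sup>2 * (g x)\<^sup>2 - 2 * s * t * (f x * g x) \<partial>M)"
      by (intro Bochner_Integration.integral_cong) (auto simp: power2_eq_square algebra_simps)
    also have "\<dots> = s\<^sup>2 * ?a\<^sup>2 + t\<^sup>2 * ?b\<^sup>2 - 2 * s * t * ?I"
      using L2_spaceD[OF f] L2_spaceD[OF g] L2_mult_integrable[OF f g]
      by (simp add: L2_norm_square)
    finally show ?thesis by simp
  qed
  have "?a = 0 \<or> ?b = 0 \<or> (?a > 0 \<and> ?b > 0)"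
    using L2_norm_nonneg[of M f] L2_norm_nonneg[of M g] by linarith
  then show ?thesis
  proof (elim disjE conjE)
    assume a: "?a = 0"
    (* Letting s grow rules out every positive value of the integral. *)
    show ?thesis
    proof (rule ccontr)
      assume "\<not> ?thesis"
      then have pos: "?I > 0" using a by simp
      have "2 * ((?b\<^sup>2 + 1) / ?I) * ?I \<le> ?b\<^sup>2"
        using q[of "(?b\<^sup>2 + 1) / ?I" 1] a by simp
      then show False using pos by simp (smt (verit) zero_le_power2)
    qed
  next
    assume b: "?b = 0"
    show ?thesis
    proof (rule ccontr)
      assume "\<not> ?thesis"
      then have pos: "?I > 0" using b by simp
      have "2 * ((?a\<^sup>2 + 1) / ?I) * ?I \<le> ?a\<^sup>2"
        using q[of 1 "(?a\<^sup>2 + 1) / ?I"] b by simp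
      then show False using pos by simp (smt (verit) zero_le_power2)
    qed
  next
    assume pos: "?a > 0" "?b > 0"
    have "2 * ?b * ?a * ?I \<le> 2 * ?b * ?a * (?a * ?b)"
      using q[of ?b ?a] by (simp add: power2_eq_square algebra_simps)
    then show ?thesis
      using pos by (simp add: mult_le_cancel_left)
  qed
qed

lemma L2_norm_triangle:
  assumes f: "f \<in> L2_space M" and g: "g \<in> L2_space M"
  shows "L2_norm M (\<lambda>x. f x + g x) \<le> L2_norm M f + L2_norm M g"
proof (rule power2_le_imp_le)
  have "(L2_norm M (\<lambda>x. f x + g x))\<^sup>2 =
      (L2_norm M f)\<^sup>2 + (L2_norm M g)\<^sup>2 + 2 * (\<integral>x. f x * g x \<partial>M)"
    using L2_spaceD[OF f] L2_spaceD[OF g] L2_mult_integrable[OF f g]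
    by (simp add: L2_norm_square power2_sum mult.assoc)
  then show "(L2_norm M (\<lambda>x. f x + g x))\<^sup>2 \<le> (L2_norm M f + L2_norm M g)\<^sup>2"
    using L2_Cauchy_Schwarz[OF f g] by (simp add: power2_sum)
qed (simp add: L2_norm_nonneg)

lemma L2_norm_sum_le:
  assumes "\<And>i. i \<in> I \<Longrightarrow> f i \<in> L2_space M"
  shows "L2_norm M (\<lambda>x. \<Sum>i\<in>I. f i x) \<le> (\<Sum>i\<in>I. L2_norm M (f i))"
  using assms
proof (induction I rule: infinite_finite_induct)
  case (insert i I)
  then have "L2_norm M (\<lambda>x. f i x + (\<Sum>i\<in>I. f i x)) \<le>
      L2_norm M (f i) + L2_norm M (\<lambda>x. \<Sum>i\<in>I. f i x)"
    by (intro L2_norm_triangle L2_sum) auto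
  then show ?case using insert by fastforce
qed (auto simp: L2_norm_def)

lemma (in prob_space) L1_le_L2_norm:
  assumes f: "f \<in> L2_space M"
  shows "integrable M f" "(\<integral>x. f x \<partial>M) \<le> L2_norm M f"
proof -
  have one: "(\<lambda>x. 1) \<in> L2_space M"
    by (simp add: L2_space_def)
  show "integrable M f"
    using L2_mult_integrable[OF f one] by simp
  show "(\<integral>x. f x \<partial>M) \<le> L2_norm M f"
    using L2_Cauchy_Schwarz[OF f one] by (simp add: L2_norm_def prob_space)
qed

text \<open>Fatou's lemma for the squares. It takes the place of completeness of \<open>L\<^sup>2\<close>: limits are found
almost everywhere, and bounds on the norms of partial sums pass to them.\<close>

lemma L2_Fatou:
  fixes f :: "nat \<Rightarrow> 'a \<Rightarrow> real"
  assumes f: "\<And>n. f n \<in> L2_space M" and g[measurable]: "g \<in> borel_measurable M"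
    and lim: "AE x in M. (\<lambda>n. f n x) \<longlonglongrightarrow> g x"
    and bound: "\<And>n. L2_norm M (f n) \<le> C"
  shows "g \<in> L2_space M" "L2_norm M g \<le> C"
proof -
  have [measurable]: "f n \<in> borel_measurable M" for n
    using f L2_spaceD by auto
  have C: "0 \<le> C"
    using bound[of 0] L2_norm_nonneg[of M "f 0"] by linarith
  have "(\<integral>\<^sup>+x. ennreal ((g x)\<^sup>2) \<partial>M) = (\<integral>\<^sup>+x. liminf (\<lambda>n. ennreal ((f n x)\<^sup>2)) \<partial>M)"
  proof (rule nn_integral_cong_AE)
    show "AE x in M. ennreal ((g x)\<^sup>2) = liminf (\<lambda>n. ennreal ((f n x)\<^sup>2))"
      using lim
    proof eventually_elim
      case (elim x)
      then have "(\<lambda>n. ennreal ((f n x)\<^sup>2)) \<longlonglongrightarrow> ennreal ((g x)\<^sup>2)"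
        by (intro tendsto_ennrealI tendsto_power)
      then show ?case
        using lim_imp_Liminf[OF sequentially_bot] by metis
    qed
  qed
  also have "\<dots> \<le> liminf (\<lambda>n. \<integral>\<^sup>+x. ennreal ((f n x)\<^sup>2) \<partial>M)"
    by (rule nn_integral_liminf) simp
  also have "\<dots> \<le> liminf (\<lambda>n. ennreal (C\<^sup>2))"
  proof (rule Liminf_mono, rule always_eventually, rule allI)
    fix n
    have "(\<integral>\<^sup>+x. ennreal ((f n x)\<^sup>2) \<partial>M) = ennreal ((L2_norm M (f n))\<^sup>2)"
      using L2_spaceD[OF f[of n]] by (simp add: L2_norm_square nn_integral_eq_integral)
    then show "(\<integral>\<^sup>+x. ennreal ((f n x)\<^sup>2) \<partial>M) \<le> ennreal (C\<^sup>2)"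
      using bound[of n] L2_norm_nonneg[of M "f n"] C by (simp add: ennreal_leI power_mono)
  qed
  finally have le: "(\<integral>\<^sup>+x. ennreal ((g x)\<^sup>2) \<partial>M) \<le> ennreal (C\<^sup>2)"
    by (simp add: Liminf_const)
  then have int: "integrable M (\<lambda>x. (g x)\<^sup>2)"
    by (intro integrableI_nonneg) (auto simp: le_less_trans)
  then show "g \<in> L2_space M"
    by (simp add: L2_space_def)
  have "(L2_norm M g)\<^sup>2 \<le> C\<^sup>2"
    using le int by (simp add: L2_norm_square nn_integral_eq_integral)
  then show "L2_norm M g \<le> C"
    using C by (rule power2_le_imp_le)
qed

section \<open>A maximal inequality\<close>

text \<open>The running maximum is started at 0. For a sequence that starts at 0 this is the ordinary
running maximum, and for every sequence it makes the maximum nonnegative.\<close>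

primrec runmax :: "(nat \<Rightarrow> real) \<Rightarrow> nat \<Rightarrow> real" where
  "runmax s 0 = 0"
| "runmax s (Suc i) = max (runmax s i) (s (Suc i))"

lemma runmax_ge:
  assumes "s 0 = 0" "j \<le> i"
  shows "s j \<le> runmax s i"
  using assms(2)
proof (induction i)
  case 0
  then show ?case using assms(1) by simp
next
  case (Suc i)
  then show ?case by (cases "j = Suc i") auto
qed

lemma runmax_measurable:
  fixes s :: "nat \<Rightarrow> 'a \<Rightarrow> real"
  assumes "\<And>j. j \<le> i \<Longrightarrow> s j \<in> borel_measurable G"
  shows "(\<lambda>x. runmax (\<lambda>j. s j x) i) \<in> borel_measurable G"
  using assms
proof (induction i)
  case (Suc i)
  then have [measurable]: "(\<lambda>x. runmax (\<lambda>j. s j x) i) \<in> borel_measurable G"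
    "s (Suc i) \<in> borel_measurable G"
    by auto
  show ?case by simp
qed simp

lemma runmax_L2:
  fixes s :: "nat \<Rightarrow> 'a \<Rightarrow> real"
  assumes "\<And>i. s i \<in> L2_space M"
  shows "(\<lambda>x. runmax (\<lambda>j. s j x) i) \<in> L2_space M"
  by (induction i) (auto simp: L2_zero intro: L2_max assms)

text \<open>Doob's inequality in \<open>L\<^sup>2\<close> by a pathwise argument, without stopping times. With \<open>m\<close> the running
maximum of \<open>s\<close>, the quantity \<open>2 m s - m\<^sup>2\<close> increases in each step by at least \<open>2 m\<close> times the
increment of \<open>s\<close>, whose integral vanishes because martingale increments are orthogonal to the
past. Hence the integral of \<open>2 m s - m\<^sup>2\<close> stays nonnegative, and the Cauchy-Schwarz inequality
gives the factor 2.\<close>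

lemma Doob_maximal:
  fixes s :: "nat \<Rightarrow> 'a \<Rightarrow> real"
  assumes s: "\<And>i. s i \<in> L2_space M"
    and orth: "\<And>i. i < L \<Longrightarrow>
      (\<integral>x. runmax (\<lambda>j. s j x) i * (s (Suc i) x - s i x) \<partial>M) = 0"
  shows "L2_norm M (\<lambda>x. runmax (\<lambda>j. s j x) L) \<le> 2 * L2_norm M (s L)"
proof -
  define m where "m i x = runmax (\<lambda>j. s j x) i" for i x
  have m: "m i \<in> L2_space M" for i
    unfolding m_def using s by (rule runmax_L2)
  note [simp] = L2_mult_integrable[OF m s] L2_spaceD(2)[OF m]
  have "0 \<le> (\<integral>x. 2 * (m i x * s i x) - (m i x)\<^sup>2 \<partial>M)" if "i \<le> L" for i
    using that
  proof (induction i)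
    case (Suc i)
    have int: "integrable M (\<lambda>x. m i x * (s (Suc i) x - s i x))"
      by (intro L2_mult_integrable m L2_diff s)
    have "0 \<le> (\<integral>x. 2 * (m i x * s i x) - (m i x)\<^sup>2 \<partial>M)"
      using Suc by simp
    also have "\<dots> = (\<integral>x. (2 * (m i x * s i x) - (m i x)\<^sup>2)
        + 2 * (m i x * (s (Suc i) x - s i x)) \<partial>M)"
      using orth[of i] Suc.prems int by (simp add: m_def[symmetric])
    also have "\<dots> \<le> (\<integral>x. 2 * (m (Suc i) x * s (Suc i) x) - (m (Suc i) x)\<^sup>2 \<partial>M)"
    proof (rule integral_mono)
      fix x
      (* At a new maximum the right-hand side becomes the square of the new value, and
         2 m s' - m^2 is at most s'^2; otherwise both sides agree. *)
      have "2 * (m i x * s (Suc i) x) \<le> (s (Suc i) x)\<^sup>2 + (m i x)\<^sup>2"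
        using sum_squares_bound[of "m i x" "s (Suc i) x"] by simp
      then show "(2 * (m i x * s i x) - (m i x)\<^sup>2) + 2 * (m i x * (s (Suc i) x - s i x))
          \<le> 2 * (m (Suc i) x * s (Suc i) x) - (m (Suc i) x)\<^sup>2"
        by (auto simp: m_def max_def algebra_simps power2_eq_square)
    qed (use int in simp_all)
    finally show ?case .
  qed (simp add: m_def)
  from this[of L] have "(L2_norm M (m L))\<^sup>2 \<le> 2 * (\<integral>x. m L x * s L x \<partial>M)"
    by (simp add: L2_norm_square)
  also have "\<dots> \<le> L2_norm M (m L) * (2 * L2_norm M (s L))"
    using L2_Cauchy_Schwarz[OF m[of L] s[of L]] by simp
  finally have "L2_norm M (m L) \<le> 2 * L2_norm M (s L)"
    using L2_norm_nonneg[of M "m L"] L2_norm_nonneg[of M "s L"]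
    by (cases "L2_norm M (m L) = 0") (auto simp: power2_eq_square mult_le_cancel_left)
  then show ?thesis
    by (simp add: m_def[abs_def])
qed

section \<open>Reverse martingale differences\<close>

text \<open>Reverse martingale differences, with the conditional expectation of \<open>X n\<close> given the smaller
algebra \<open>F (Suc n)\<close> being zero expressed as orthogonality. The past grows when the index
decreases, so a finite stretch of such a sequence is a martingale when it is summed from its
right end.\<close>

locale reverse_mds = prob_space M
  for M :: "'a measure" and F :: "nat \<Rightarrow> 'a measure" and X :: "nat \<Rightarrow> 'a \<Rightarrow> real" +
  assumes subalgebra: "\<And>n. subalgebra M (F n)"
    and decreasing: "decseq (\<lambda>n. sets (F n))"
    and X_L2: "\<And>n. X n \<in> L2_space M"
    and X_measurable: "\<And>n. X n \<in> borel_measurable (F n)"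
    and orthogonal: "\<And>n h. h \<in> L2_space M \<Longrightarrow> h \<in> borel_measurable (F (Suc n)) \<Longrightarrow>
      (\<integral>x. h x * X n x \<partial>M) = 0"
begin

lemma shift: "reverse_mds M (\<lambda>n. F (n + p)) (\<lambda>n. X (n + p))"
proof unfold_locales
  show "decseq (\<lambda>n. sets (F (n + p)))"
    using decreasing by (simp add: decseq_def)
qed (auto intro: subalgebra X_L2 X_measurable orthogonal)

lemma X_measurable': "m \<le> n \<Longrightarrow> X n \<in> borel_measurable (F m)"
proof (rule measurable_from_subalg[OF _ X_measurable])
  assume "m \<le> n"
  then show "subalgebra (F m) (F n)"
    using subalgebra[of m] subalgebra[of n] decreasing by (auto simp: subalgebra_def decseq_def)
qed

lemma X_borel[measurable]: "X n \<in> borel_measurable M"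
  using X_L2 by (rule L2_spaceD)

lemma partial_sum_L2: "(\<lambda>x. \<Sum>n\<in>I. X n x) \<in> L2_space M"
  by (intro L2_sum X_L2)

lemma Pythagoras:
  "(L2_norm M (\<lambda>x. \<Sum>n<N. X n x))\<^sup>2 = (\<Sum>n<N. (L2_norm M (X n))\<^sup>2)"
proof (induction N)
  case (Suc N)
  have cross: "(\<integral>x. (\<Sum>n<N. X n x) * X N x \<partial>M) = 0"
  proof -
    have "(\<integral>x. (\<Sum>n<N. X n x) * X N x \<partial>M) = (\<Sum>n<N. \<integral>x. X N x * X n x \<partial>M)"
      unfolding sum_distrib_right
      by (subst Bochner_Integration.integral_sum)
        (auto intro: L2_mult_integrable X_L2 simp: mult.commute)
    also have "\<dots> = 0"
      by (intro sum.neutral ballI orthogonal X_L2 X_measurable') auto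
    finally show ?thesis .
  qed
  have "(L2_norm M (\<lambda>x. \<Sum>n<Suc N. X n x))\<^sup>2 =
      (\<integral>x. (\<Sum>n<N. X n x)\<^sup>2 + (X N x)\<^sup>2 + 2 * ((\<Sum>n<N. X n x) * X N x) \<partial>M)"
    by (simp add: L2_norm_square power2_sum mult.assoc)
  also have "\<dots> = (L2_norm M (\<lambda>x. \<Sum>n<N. X n x))\<^sup>2 + (L2_norm M (X N))\<^sup>2"
    using cross L2_mult_integrable[OF partial_sum_L2[of "{..<N}"] X_L2[of N]]
      L2_spaceD(2)[OF partial_sum_L2[of "{..<N}"]] L2_spaceD(2)[OF X_L2[of N]]
    by (simp add: L2_norm_square)
  finally show ?case
    using Suc by simp
qed (simp add: L2_norm_def)

lemma partial_sum_norm_le: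
  assumes "summable (\<lambda>n. (L2_norm M (X n))\<^sup>2)"
  shows "L2_norm M (\<lambda>x. \<Sum>n<N. X n x) \<le> sqrt (\<Sum>n. (L2_norm M (X n))\<^sup>2)"
proof (rule real_le_rsqrt)
  show "(L2_norm M (\<lambda>x. \<Sum>n<N. X n x))\<^sup>2 \<le> (\<Sum>n. (L2_norm M (X n))\<^sup>2)"
    unfolding Pythagoras using assms by (intro sum_le_suminf) auto
qed

text \<open>The sums over \<open>{L - i..<L}\<close> form a martingale in \<open>i\<close>, to which Doob's inequality applies. The sign
\<open>c\<close> serves to bound the sums from above and from below separately.\<close>

lemma maximal_one_sided:
  assumes c: "c = 1 \<or> c = -1"
  shows "L2_norm M (\<lambda>x. runmax (\<lambda>i. c * (\<Sum>n\<in>{L - i..<L}. X n x)) L)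
    \<le> 2 * L2_norm M (\<lambda>x. \<Sum>n<L. X n x)"
proof -
  define s where "s i x = c * (\<Sum>n\<in>{L - i..<L}. X n x)" for i x
  have "L2_norm M (\<lambda>x. runmax (\<lambda>j. s j x) L) \<le> 2 * L2_norm M (s L)"
  proof (rule Doob_maximal)
    show s: "s i \<in> L2_space M" for i
      unfolding s_def by (intro L2_cmult partial_sum_L2)
    show "(\<integral>x. runmax (\<lambda>j. s j x) i * (s (Suc i) x - s i x) \<partial>M) = 0" if "i < L" for i
    proof -
      (* Revealing one more term from the right end adds the term of index L - Suc i. *)
      have eq: "{L - Suc i..<L} = insert (L - Suc i) {L - i..<L}" "Suc (L - Suc i) = L - i"
        using that by auto
      have step: "s (Suc i) x - s i x = c * X (L - Suc i) x" for x
        using that unfolding s_def eq(1) by (simp add: algebra_simps)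
      have "(\<lambda>x. runmax (\<lambda>j. s j x) i) \<in> borel_measurable (F (Suc (L - Suc i)))"
      proof (rule runmax_measurable)
        fix j assume "j \<le> i"
        then show "s j \<in> borel_measurable (F (Suc (L - Suc i)))"
          unfolding s_def eq(2) by (intro borel_measurable_times borel_measurable_sum
            X_measurable' borel_measurable_const) auto
      qed
      from orthogonal[OF runmax_L2[OF s] this] show ?thesis
        by (simp add: step mult.left_commute)
    qed
  qed
  moreover have "L2_norm M (s L) = L2_norm M (\<lambda>x. \<Sum>n<L. X n x)"
    using c by (auto simp: s_def[abs_def] atLeast0LessThan L2_norm_def)
  ultimately show ?thesis
    by (simp add: s_def)
qed

text \<open>A sum over an initial segment is the full sum up to \<open>L\<close> minus a sum over \<open>{N..<L}\<close>. Both are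
controlled by the maxima of the reversed sums and of their negatives, each of norm at most twice
that of the full sum; together they give the factor 4.\<close>

lemma maximal_finite:
  assumes "summable (\<lambda>n. (L2_norm M (X n))\<^sup>2)"
  shows "(\<integral>\<^sup>+x. (SUP N\<in>{..L}. ennreal \<bar>\<Sum>n<N. X n x\<bar>) \<partial>M)
    \<le> ennreal (4 * sqrt (\<Sum>n. (L2_norm M (X n))\<^sup>2))"
proof -
  define s where "s c i x = c * (\<Sum>n\<in>{L - i..<L}. X n x)" for c :: real and i x
  define m where "m c x = runmax (\<lambda>i. s c i x) L" for c x
  have m_L2: "m c \<in> L2_space M" for c
    unfolding m_def s_def by (intro runmax_L2 L2_cmult partial_sum_L2)
  have m_le: "L2_norm M (m c) \<le> 2 * sqrt (\<Sum>n. (L2_norm M (X n))\<^sup>2)"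
    if "c = 1 \<or> c = -1" for c
    using maximal_one_sided[OF that, of L] partial_sum_norm_le[OF assms, of L]
    by (simp add: m_def[abs_def] s_def)
  have s_le: "s c i x \<le> m c x" if "i \<le> L" for c i x
    unfolding m_def by (rule runmax_ge[of "\<lambda>i. s c i x"]) (simp_all add: s_def that)
  have bound: "\<bar>\<Sum>n<N. X n x\<bar> \<le> m 1 x + m (-1) x" if "N \<le> L" for N x
  proof -
    have "{..<L} = {..<N} \<union> {N..<L}" "{..<N} \<inter> {N..<L} = {}"
      using that by auto
    then have split: "(\<Sum>n<L. X n x) = (\<Sum>n<N. X n x) + (\<Sum>n\<in>{N..<L}. X n x)"
      by (simp add: sum.union_disjoint)
    have "s c L x = c * (\<Sum>n<L. X n x)" "s c (L - N) x = c * (\<Sum>n\<in>{N..<L}. X n x)" for c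
      using that by (simp_all add: s_def atLeast0LessThan)
    then show ?thesis
      using s_le[of L 1 x] s_le[of L "-1" x] s_le[of "L - N" 1 x] s_le[of "L - N" "-1" x] split
      by simp
  qed
  have "(\<integral>\<^sup>+x. (SUP N\<in>{..L}. ennreal \<bar>\<Sum>n<N. X n x\<bar>) \<partial>M)
      \<le> (\<integral>\<^sup>+x. ennreal (m 1 x + m (-1) x) \<partial>M)"
    by (intro nn_integral_mono SUP_least ennreal_leI) (auto intro: bound)
  also have "\<dots> = ennreal (\<integral>x. m 1 x + m (-1) x \<partial>M)"
  proof (rule nn_integral_eq_integral)
    show "AE x in M. 0 \<le> m 1 x + m (-1) x"
      using bound[of 0] by simp
  qed (intro Bochner_Integration.integrable_add L1_le_L2_norm m_L2)
  also have "(\<integral>x. m 1 x + m (-1) x \<partial>M) = (\<integral>x. m 1 x \<partial>M) + (\<integral>x. m (-1) x \<partial>M)"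
    by (intro Bochner_Integration.integral_add L1_le_L2_norm m_L2)
  also have "ennreal \<dots> \<le> ennreal (4 * sqrt (\<Sum>n. (L2_norm M (X n))\<^sup>2))"
    using L1_le_L2_norm(2)[OF m_L2[of 1]] L1_le_L2_norm(2)[OF m_L2[of "-1"]]
      m_le[of 1] m_le[of "-1"]
    by (intro ennreal_leI) simp
  finally show ?thesis .
qed

lemma maximal:
  assumes "summable (\<lambda>n. (L2_norm M (X n))\<^sup>2)"
  shows "(\<integral>\<^sup>+x. (SUP N. ennreal \<bar>\<Sum>n<N. X n x\<bar>) \<partial>M)
    \<le> ennreal (4 * sqrt (\<Sum>n. (L2_norm M (X n))\<^sup>2))"
proof -
  have "(SUP N. ennreal \<bar>\<Sum>n<N. X n x\<bar>) = (SUP L. SUP N\<in>{..L}. ennreal \<bar>\<Sum>n<N. X n x\<bar>)" for x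
    by (rule antisym) (auto intro!: SUP_least intro: SUP_upper SUP_upper2)
  then have "(\<integral>\<^sup>+x. (SUP N. ennreal \<bar>\<Sum>n<N. X n x\<bar>) \<partial>M)
      = (\<integral>\<^sup>+x. (SUP L. SUP N\<in>{..L}. ennreal \<bar>\<Sum>n<N. X n x\<bar>) \<partial>M)"
    by simp
  also have "\<dots> = (SUP L. \<integral>\<^sup>+x. (SUP N\<in>{..L}. ennreal \<bar>\<Sum>n<N. X n x\<bar>) \<partial>M)"
    by (intro nn_integral_monotone_convergence_SUP)
      (auto simp: incseq_def le_fun_def intro!: SUP_subset_mono borel_measurable_SUP)
  also have "\<dots> \<le> ennreal (4 * sqrt (\<Sum>n. (L2_norm M (X n))\<^sup>2))"
    by (intro SUP_least maximal_finite assms)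
  finally show ?thesis .
qed

text \<open>The maximal inequality for the shifted sequence bounds the oscillation of the partial sums beyond
\<open>p\<close> by a multiple of the remainder of the series of squared norms. The infimum of these
oscillations over \<open>p\<close> therefore has integral 0, which is the Cauchy criterion almost everywhere.\<close>

lemma AE_summable:
  assumes sq: "summable (\<lambda>n. (L2_norm M (X n))\<^sup>2)"
  shows "AE x in M. summable (\<lambda>n. X n x)"
proof -
  define D where "D p x = (SUP N. ennreal \<bar>\<Sum>n<N. X (n + p) x\<bar>)" for p x
  define t where "t p = 4 * sqrt (\<Sum>n. (L2_norm M (X (n + p)))\<^sup>2)" for p
  have [measurable]: "D p \<in> borel_measurable M" for p
    unfolding D_def by measurable
  have D_le: "(\<integral>\<^sup>+x. D p x \<partial>M) \<le> ennreal (t p)" for p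
    unfolding D_def t_def
    by (intro reverse_mds.maximal[OF shift] summable_ignore_initial_segment[OF sq])
  have "(\<lambda>p. \<Sum>n. (L2_norm M (X (n + p)))\<^sup>2) \<longlonglongrightarrow> 0"
    using suminf_exist_split2[OF sq] by simp
  then have "t \<longlonglongrightarrow> 4 * sqrt 0"
    unfolding t_def by (intro tendsto_mult tendsto_real_sqrt tendsto_const)
  then have t0: "(\<lambda>p. ennreal (t p)) \<longlonglongrightarrow> ennreal 0"
    by (intro tendsto_ennrealI) simp
  have "(\<integral>\<^sup>+x. (INF p. D p x) \<partial>M) \<le> ennreal 0"
  proof (rule LIMSEQ_le_const[OF t0], intro exI allI impI)
    fix p :: nat
    have "(\<integral>\<^sup>+x. (INF p. D p x) \<partial>M) \<le> (\<integral>\<^sup>+x. D p x \<partial>M)"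
      by (intro nn_integral_mono INF_lower) auto
    then show "(\<integral>\<^sup>+x. (INF p. D p x) \<partial>M) \<le> ennreal (t p)"
      using D_le[of p] by (rule order_trans)
  qed
  then have "AE x in M. (INF p. D p x) = 0"
    by (subst nn_integral_0_iff_AE[symmetric]) auto
  then show ?thesis
  proof eventually_elim
    case (elim x)
    show ?case
      unfolding summable_Cauchy
    proof (intro allI impI)
      fix e :: real assume "0 < e"
      then have "(INF p. D p x) < ennreal (e / 2)"
        using elim by simp
      then obtain p where p: "D p x < ennreal (e / 2)"
        by (auto simp: INF_less_iff)
      have small: "\<bar>\<Sum>n<N. X (n + p) x\<bar> < e / 2" for N
      proof -
        have "ennreal \<bar>\<Sum>n<N. X (n + p) x\<bar> \<le> D p x"
          unfolding D_def by (rule SUP_upper) simp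
        then show ?thesis
          using p \<open>0 < e\<close> by (metis abs_ge_zero ennreal_less_iff le_less_trans)
      qed
      have "norm (sum (\<lambda>n. X n x) {m..<k}) < e" if "m \<ge> p" for m k
      proof (cases "m \<le> k")
        case True
        have tail: "(\<Sum>n<i - p. X (n + p) x) = (\<Sum>n\<in>{p..<i}. X n x)" if "p \<le> i" for i
          using sum.shift_bounds_nat_ivl[of "\<lambda>n. X n x" 0 p "i - p"] that
          by (simp add: atLeast0LessThan)
        have "(\<Sum>n\<in>{p..<m}. X n x) + (\<Sum>n\<in>{m..<k}. X n x) = (\<Sum>n\<in>{p..<k}. X n x)"
          using that True by (intro sum.atLeastLessThan_concat)
        then show ?thesis
          using small[of "m - p"] small[of "k - p"] tail[of m] tail[of k] that True by simp
      qed (use \<open>0 < e\<close> in simp)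
      then show "\<exists>N. \<forall>m\<ge>N. \<forall>n. norm (sum (\<lambda>n. X n x) {m..<n}) < e"
        by blast
    qed
  qed
qed

lemma sum_L2:
  assumes sq: "summable (\<lambda>n. (L2_norm M (X n))\<^sup>2)"
  shows "(\<lambda>x. \<Sum>n. X n x) \<in> L2_space M"
    "L2_norm M (\<lambda>x. \<Sum>n. X n x) \<le> sqrt (\<Sum>n. (L2_norm M (X n))\<^sup>2)"
proof -
  have lim: "AE x in M. (\<lambda>N. \<Sum>n<N. X n x) \<longlonglongrightarrow> (\<Sum>n. X n x)"
    using AE_summable[OF sq] by eventually_elim (rule summable_LIMSEQ)
  note * = partial_sum_L2 _ lim partial_sum_norm_le[OF sq]
  show "(\<lambda>x. \<Sum>n. X n x) \<in> L2_space M"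
    by (rule L2_Fatou(1)[OF *]) simp
  show "L2_norm M (\<lambda>x. \<Sum>n. X n x) \<le> sqrt (\<Sum>n. (L2_norm M (X n))\<^sup>2)"
    by (rule L2_Fatou(2)[OF *]) simp
qed

end

section \<open>Families of reverse martingale differences\<close>

text \<open>Dominated convergence for series. It is used for the values at a point of \<open>M\<close> and again for the
\<open>L\<^sup>2\<close> norms of the remainders.\<close>

lemma Tannery:
  fixes a :: "nat \<Rightarrow> nat \<Rightarrow> real"
  assumes lim: "\<And>k. (\<lambda>N. a k N) \<longlonglongrightarrow> b k"
    and bound: "\<And>k N. \<bar>a k N\<bar> \<le> w k" and w: "summable w"
  shows "summable (\<lambda>k. a k N)" "summable b" "(\<lambda>N. \<Sum>k. a k N) \<longlonglongrightarrow> (\<Sum>k. b k)"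
proof -
  have b: "\<bar>b k\<bar> \<le> w k" for k
    by (rule LIMSEQ_le_const2[OF tendsto_rabs[OF lim]]) (use bound in blast)
  show a_sum: "summable (\<lambda>k. a k N)" for N
    using bound by (intro summable_comparison_test'[OF w]) simp
  show b_sum: "summable b"
    using b by (intro summable_comparison_test'[OF w]) simp
  have int: "integrable (count_space UNIV) (\<lambda>k. a k N)" "integrable (count_space UNIV) b" for N
    using bound b by (auto simp: integrable_count_space_nat_iff intro!: summable_comparison_test'[OF w])
  have "(\<lambda>N. integral\<^sup>L (count_space UNIV) (\<lambda>k. a k N)) \<longlonglongrightarrow> integral\<^sup>L (count_space UNIV) b"
  proof (rule integral_dominated_convergence)
    have "0 \<le> w k" for k
      using bound[of k 0] by linarith
    then show "integrable (count_space UNIV) w"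
      using w by (simp add: integrable_count_space_nat_iff)
  qed (use lim bound in auto)
  then show "(\<lambda>N. \<Sum>k. a k N) \<longlonglongrightarrow> (\<Sum>k. b k)"
    using int by (simp add: integral_count_space_nat)
qed

locale reverse_mds_family =
  fixes M :: "'a measure" and F :: "nat \<Rightarrow> nat \<Rightarrow> 'a measure"
    and X :: "nat \<Rightarrow> nat \<Rightarrow> 'a \<Rightarrow> real"
  assumes mds: "\<And>k. reverse_mds M (F k) (X k)"
    and square_summable: "\<And>k. summable (\<lambda>n. (L2_norm M (X k n))\<^sup>2)"
    and norms_summable: "summable (\<lambda>k. sqrt (\<Sum>n. (L2_norm M (X k n))\<^sup>2))"
begin

lemma tail_norm_le:
  "sqrt (\<Sum>n. (L2_norm M (X k (n + p)))\<^sup>2) \<le> sqrt (\<Sum>n. (L2_norm M (X k n))\<^sup>2)"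
proof -
  have "(\<Sum>n. (L2_norm M (X k n))\<^sup>2) =
      (\<Sum>n. (L2_norm M (X k (n + p)))\<^sup>2) + (\<Sum>n<p. (L2_norm M (X k n))\<^sup>2)"
    by (rule suminf_split_initial_segment[OF square_summable])
  then show ?thesis
    by (simp add: sum_nonneg)
qed

lemma shift_family: "reverse_mds_family M (\<lambda>k n. F k (n + p k)) (\<lambda>k n. X k (n + p k))"
proof (rule reverse_mds_family.intro)
  show "reverse_mds M (\<lambda>n. F k (n + p k)) (\<lambda>n. X k (n + p k))" for k
    by (rule reverse_mds.shift[OF mds])
  show "summable (\<lambda>n. (L2_norm M (X k (n + p k)))\<^sup>2)" for k
    by (rule summable_ignore_initial_segment[OF square_summable])
  show "summable (\<lambda>k. sqrt (\<Sum>n. (L2_norm M (X k (n + p k)))\<^sup>2))"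
  proof (rule summable_comparison_test'[OF norms_summable])
    fix k :: nat
    have "0 \<le> (\<Sum>n. (L2_norm M (X k (n + p k)))\<^sup>2)"
      by (intro suminf_nonneg summable_ignore_initial_segment[OF square_summable]) simp
    then show "norm (sqrt (\<Sum>n. (L2_norm M (X k (n + p k)))\<^sup>2))
        \<le> sqrt (\<Sum>n. (L2_norm M (X k n))\<^sup>2)"
      using tail_norm_le[of k "p k"] by simp
  qed
qed

text \<open>The maximal functions of the rows have integrals that are bounded by a multiple of their norms,
so these maximal functions have a finite sum almost everywhere. They serve as a dominating series
for the partial sums of all rows at once.\<close>

lemma AE_dominated:
  "AE x in M. (\<forall>k. summable (\<lambda>n. X k n x)) \<and>
     (\<exists>w. summable w \<and> (\<forall>k N. \<bar>\<Sum>n<N. X k n x\<bar> \<le> w k))"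
proof -
  define D where "D k x = (SUP N. ennreal \<bar>\<Sum>n<N. X k n x\<bar>)" for k x
  have [measurable]: "X k n \<in> borel_measurable M" for k n
    by (rule reverse_mds.X_borel[OF mds])
  have [measurable]: "D k \<in> borel_measurable M" for k
    unfolding D_def by measurable
  have "(\<integral>\<^sup>+x. (\<Sum>k. D k x) \<partial>M) = (\<Sum>k. \<integral>\<^sup>+x. D k x \<partial>M)"
    by (rule nn_integral_suminf) simp
  also have "\<dots> \<le> (\<Sum>k. ennreal (4 * sqrt (\<Sum>n. (L2_norm M (X k n))\<^sup>2)))"
    unfolding D_def
    by (intro suminf_le reverse_mds.maximal[OF mds] square_summable) auto
  also have "\<dots> < \<infinity>"
  proof -
    have "(\<Sum>k. ennreal (4 * sqrt (\<Sum>n. (L2_norm M (X k n))\<^sup>2)))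
        = ennreal (\<Sum>k. 4 * sqrt (\<Sum>n. (L2_norm M (X k n))\<^sup>2))"
      by (intro suminf_ennreal2 summable_mult norms_summable)
        (auto intro!: suminf_nonneg square_summable)
    then show ?thesis by simp
  qed
  finally have "AE x in M. (\<Sum>k. D k x) \<noteq> \<infinity>"
    by (intro nn_integral_PInf_AE) auto
  moreover have "AE x in M. \<forall>k. summable (\<lambda>n. X k n x)"
    unfolding AE_all_countable by (intro allI reverse_mds.AE_summable[OF mds] square_summable)
  ultimately show ?thesis
  proof eventually_elim
    case (elim x)
    have fin: "D k x < top" for k
    proof -
      have "D k x \<le> (\<Sum>k. D k x)"
        using sum_le_suminf[of "\<lambda>k. D k x" "{k}"] by simp
      then show ?thesis
        using elim(1) by (simp add: less_top le_less_trans)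
    qed
    have "summable (\<lambda>k. enn2real (D k x))"
    proof (rule summable_suminf_not_top)
      show "(\<Sum>k. ennreal (enn2real (D k x))) \<noteq> top"
        using elim(1) fin by simp
    qed simp
    moreover have "\<bar>\<Sum>n<N. X k n x\<bar> \<le> enn2real (D k x)" for k N
    proof -
      have "ennreal \<bar>\<Sum>n<N. X k n x\<bar> \<le> D k x"
        unfolding D_def by (rule SUP_upper) simp
      then show ?thesis
        using fin[of k] enn2real_mono[of "ennreal \<bar>\<Sum>n<N. X k n x\<bar>" "D k x"] by simp
    qed
    ultimately show ?case
      using elim(2) by blast
  qed
qed

text \<open>The bound on a row is uniform in the length of the partial sum. Dominated convergence therefore
tolerates a delay \<open>c k\<close> in row \<open>k\<close>, however fast the delays grow.\<close>

lemma double_sum_AE: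
  "AE x in M. (\<forall>k. summable (\<lambda>n. X k n x)) \<and> summable (\<lambda>k. \<Sum>n. X k n x) \<and>
     (\<forall>N. summable (\<lambda>k. \<Sum>n<N - c k. X k n x)) \<and>
     (\<lambda>N. \<Sum>k. \<Sum>n<N - c k. X k n x) \<longlonglongrightarrow> (\<Sum>k. \<Sum>n. X k n x)"
  using AE_dominated
proof eventually_elim
  case (elim x)
  then obtain w where w: "summable w" "\<And>k N. \<bar>\<Sum>n<N. X k n x\<bar> \<le> w k"
    and X: "\<And>k. summable (\<lambda>n. X k n x)"
    by blast
  have "(\<lambda>N. \<Sum>n<N - c k. X k n x) \<longlonglongrightarrow> (\<Sum>n. X k n x)" for k
    by (rule filterlim_compose[OF summable_LIMSEQ[OF X] filterlim_minus_const_nat_at_top])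
  from Tannery[OF this w(2) w(1)] show ?case
    using X by blast
qed

lemma double_sum_L2:
  shows "(\<lambda>x. \<Sum>k. \<Sum>n. X k n x) \<in> L2_space M"
    "L2_norm M (\<lambda>x. \<Sum>k. \<Sum>n. X k n x) \<le> (\<Sum>k. sqrt (\<Sum>n. (L2_norm M (X k n))\<^sup>2))"
proof -
  have [measurable]: "X k n \<in> borel_measurable M" for k n
    by (rule reverse_mds.X_borel[OF mds])
  note row = reverse_mds.sum_L2[OF mds square_summable]
  have L2: "(\<lambda>x. \<Sum>k<K. \<Sum>n. X k n x) \<in> L2_space M" for K
    by (intro L2_sum row)
  have meas: "(\<lambda>x. \<Sum>k. \<Sum>n. X k n x) \<in> borel_measurable M"
    by measurable
  have lim: "AE x in M. (\<lambda>K. \<Sum>k<K. \<Sum>n. X k n x) \<longlonglongrightarrow> (\<Sum>k. \<Sum>n. X k n x)"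
    using double_sum_AE[of "\<lambda>_. 0"] by eventually_elim (blast intro: summable_LIMSEQ)
  have bound: "L2_norm M (\<lambda>x. \<Sum>k<K. \<Sum>n. X k n x) \<le> (\<Sum>k. sqrt (\<Sum>n. (L2_norm M (X k n))\<^sup>2))" for K
  proof -
    have "L2_norm M (\<lambda>x. \<Sum>k<K. \<Sum>n. X k n x) \<le> (\<Sum>k<K. L2_norm M (\<lambda>x. \<Sum>n. X k n x))"
      by (intro L2_norm_sum_le row)
    also have "\<dots> \<le> (\<Sum>k<K. sqrt (\<Sum>n. (L2_norm M (X k n))\<^sup>2))"
      by (intro sum_mono row)
    also have "\<dots> \<le> (\<Sum>k. sqrt (\<Sum>n. (L2_norm M (X k n))\<^sup>2))"
      by (intro sum_le_suminf norms_summable)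
        (auto intro!: suminf_nonneg square_summable)
    finally show ?thesis .
  qed
  show "(\<lambda>x. \<Sum>k. \<Sum>n. X k n x) \<in> L2_space M"
    by (rule L2_Fatou(1)[OF L2 meas lim bound])
  show "L2_norm M (\<lambda>x. \<Sum>k. \<Sum>n. X k n x) \<le> (\<Sum>k. sqrt (\<Sum>n. (L2_norm M (X k n))\<^sup>2))"
    by (rule L2_Fatou(2)[OF L2 meas lim bound])
qed

text \<open>The remainder is itself the double sum of a family that is shifted by \<open>N - c k\<close> in row \<open>k\<close>. Its
norm is thus bounded by the sum of the tails of the rows, and each tail tends to 0.\<close>

lemma double_sum_remainder:
  fixes c :: "nat \<Rightarrow> nat"
  defines "R \<equiv> \<lambda>N x. (\<Sum>k. \<Sum>n. X k n x) - (\<Sum>k. \<Sum>n<N - c k. X k n x)"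
  shows "R N \<in> L2_space M" "(\<lambda>N. L2_norm M (R N)) \<longlonglongrightarrow> 0"
proof -
  have [measurable]: "X k n \<in> borel_measurable M" for k n
    by (rule reverse_mds.X_borel[OF mds])
  define r where "r k N = sqrt (\<Sum>n. (L2_norm M (X k (n + (N - c k))))\<^sup>2)" for k N
  have r_nonneg: "0 \<le> r k N" for k N
    unfolding r_def
    by (auto intro!: suminf_nonneg summable_ignore_initial_segment[OF square_summable])
  have R_eq: "AE x in M. (\<Sum>k. \<Sum>n. X k (n + (N - c k)) x) = R N x" for N
    using double_sum_AE[of c]
  proof eventually_elim
    case (elim x)
    have "(\<Sum>n. X k (n + (N - c k)) x) = (\<Sum>n. X k n x) - (\<Sum>n<N - c k. X k n x)" for k
      using elim by (intro suminf_minus_initial_segment) blast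
    then show ?case
      using elim unfolding R_def by (simp add: suminf_diff)
  qed
  have meas: "R N \<in> borel_measurable M" for N
    unfolding R_def by measurable
  note tail = reverse_mds_family.double_sum_L2[OF shift_family]
  note cong = L2_cong_AE[OF tail(1) meas R_eq]
  show "R N \<in> L2_space M" for N
    by (rule cong(1))
  have bound: "L2_norm M (R N) \<le> (\<Sum>k. r k N)" for N
    unfolding r_def cong(2)[of N] by (rule tail(2))
  have "(\<lambda>N. r k N) \<longlonglongrightarrow> 0" for k
  proof -
    have "(\<lambda>p. \<Sum>n. (L2_norm M (X k (n + p)))\<^sup>2) \<longlonglongrightarrow> 0"
      using suminf_exist_split2[OF square_summable] by simp
    then have "(\<lambda>p. sqrt (\<Sum>n. (L2_norm M (X k (n + p)))\<^sup>2)) \<longlonglongrightarrow> sqrt 0"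
      by (rule tendsto_real_sqrt)
    then show ?thesis
      unfolding r_def
      using filterlim_compose[OF _ filterlim_minus_const_nat_at_top] by fastforce
  qed
  moreover have "\<bar>r k N\<bar> \<le> sqrt (\<Sum>n. (L2_norm M (X k n))\<^sup>2)" for k N
    using r_nonneg[of k N] tail_norm_le[of k "N - c k"] by (simp add: r_def)
  ultimately have "(\<lambda>N. \<Sum>k. r k N) \<longlonglongrightarrow> (\<Sum>k. 0)"
    by (rule Tannery(3)) (rule norms_summable)
  then have r_lim: "(\<lambda>N. \<Sum>k. r k N) \<longlonglongrightarrow> 0"
    by simp
  show "(\<lambda>N. L2_norm M (R N)) \<longlonglongrightarrow> 0"
    by (rule tendsto_sandwich[OF _ _ tendsto_const r_lim]) (simp_all add: L2_norm_nonneg bound)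
qed

end

section \<open>Conditional expectations along a decreasing sequence\<close>

context sigma_finite_subalgebra
begin

lemma cond_exp_measurable_M: "real_cond_exp M F f \<in> borel_measurable M"
  by (rule measurable_from_subalg[OF subalg borel_measurable_cond_exp])

end

context finite_measure_subalgebra
begin

lemma cond_exp_L2:
  assumes f: "f \<in> L2_space M"
  shows "real_cond_exp M F f \<in> L2_space M"
proof -
  have "integrable M (\<lambda>x. (real_cond_exp M F f x)\<^sup>2)"
  proof (rule integrable_convex_cond_exp[where I = UNIV])
    show "integrable M f"
      using L2_spaceD[OF f] by (rule square_integrable_imp_integrable)
  qed (use L2_spaceD(2)[OF f] convex_power2 in simp_all)
  then show ?thesis
    by (simp add: L2_space_def)
qed

lemma cond_exp_inner:
  assumes "f \<in> L2_space M" "h \<in> L2_space M" "h \<in> borel_measurable F"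
  shows "(\<integral>x. h x * real_cond_exp M F f x \<partial>M) = (\<integral>x. h x * f x \<partial>M)"
  by (rule real_cond_exp_intg(2)[OF L2_mult_integrable[OF assms(2,1)] assms(3) L2_spaceD(1)[OF assms(1)]])

lemma cond_exp_norm_le:
  assumes f: "f \<in> L2_space M"
  shows "L2_norm M (real_cond_exp M F f) \<le> L2_norm M f"
proof -
  let ?e = "real_cond_exp M F f"
  have "(L2_norm M ?e)\<^sup>2 = (\<integral>x. ?e x * ?e x \<partial>M)"
    unfolding L2_norm_square by (simp only: power2_eq_square)
  also have "\<dots> = (\<integral>x. ?e x * f x \<partial>M)"
    by (rule cond_exp_inner[OF f cond_exp_L2[OF f]]) simp
  also have "\<dots> \<le> L2_norm M ?e * L2_norm M f"
    by (rule L2_Cauchy_Schwarz[OF cond_exp_L2[OF f] f])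
  finally show ?thesis
    using L2_norm_nonneg[of M ?e] L2_norm_nonneg[of M f]
    by (cases "L2_norm M ?e = 0") (auto simp: power2_eq_square mult_le_cancel_left)
qed

end

locale reverse_filtration = prob_space M
  for M :: "'a measure" and B :: "nat \<Rightarrow> 'a measure" +
  assumes subalgebra: "\<And>n. subalgebra M (B n)"
    and decreasing: "decseq (\<lambda>n. sets (B n))"
    and total: "sets (B 0) = sets M"
begin

sublocale B: finite_measure_subalgebra M "B n" for n
  by unfold_locales (rule subalgebra)

lemma measurable_antimono:
  assumes "m \<le> n" "f \<in> borel_measurable (B n)"
  shows "f \<in> borel_measurable (B m)"
proof (rule measurable_from_subalg[OF _ assms(2)])
  show "subalgebra (B m) (B n)"
    using assms(1) subalgebra[of m] subalgebra[of n] decreasing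
    by (auto simp: subalgebra_def decseq_def)
qed

lemma measurable_tail_algebra:
  assumes g: "\<And>n. g \<in> borel_measurable (B n)"
  shows "g \<in> borel_measurable (tail_algebra M B)"
proof (rule measurableI)
  fix A :: "'b::topological_space set" assume A: "A \<in> sets borel"
  have sp: "space (B n) = space M" "space (tail_algebra M B) = space M" for n
    using subalgebra[of n] subalgebra_tail_algebra[of M B, OF subalgebra]
    by (auto simp: subalgebra_def)
  show "g -` A \<inter> space (tail_algebra M B) \<in> sets (tail_algebra M B)"
    unfolding sets_tail_algebra[OF subalgebra] sp
    using measurable_sets[OF g A] sp by auto
qed simp

lemma cond_exp_diff_L2: "f \<in> L2_space M \<Longrightarrow> cond_exp_diff M B n f \<in> L2_space M"
  unfolding cond_exp_diff_def by (intro L2_diff B.cond_exp_L2)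

text \<open>The function that is differenced may depend on the index: only the algebras have to decrease.
This covers both diagonals of the array formed by the differences of all the functions.\<close>

lemma reverse_mds_cond_exp_diff:
  assumes f: "\<And>n. f n \<in> L2_space M"
  shows "reverse_mds M (\<lambda>n. B (n + k)) (\<lambda>n. cond_exp_diff M B (n + k) (f n))"
proof unfold_locales
  show "decseq (\<lambda>n. sets (B (n + k)))"
    using decreasing by (simp add: decseq_def)
  show "subalgebra M (B (n + k))" for n
    by (rule subalgebra)
  show "cond_exp_diff M B (n + k) (f n) \<in> L2_space M" for n
    by (rule cond_exp_diff_L2[OF f])
  show "cond_exp_diff M B (n + k) (f n) \<in> borel_measurable (B (n + k))" for n
    unfolding cond_exp_diff_def
    by (rule borel_measurable_diff[OF borel_measurable_cond_exp
          measurable_antimono[OF le_SucI[OF order_refl] borel_measurable_cond_exp]])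
  show "(\<integral>x. h x * cond_exp_diff M B (n + k) (f n) x \<partial>M) = 0"
    if h: "h \<in> L2_space M" "h \<in> borel_measurable (B (Suc n + k))" for n h
  proof -
    have h': "h \<in> borel_measurable (B (n + k))"
      using h(2) by (rule measurable_antimono[rotated]) simp
    have "(\<integral>x. h x * cond_exp_diff M B (n + k) (f n) x \<partial>M) =
        (\<integral>x. h x * real_cond_exp M (B (n + k)) (f n) x \<partial>M) -
        (\<integral>x. h x * real_cond_exp M (B (Suc (n + k))) (f n) x \<partial>M)"
      unfolding cond_exp_diff_def right_diff_distrib
      by (intro Bochner_Integration.integral_diff L2_mult_integrable h B.cond_exp_L2 f)
    also have "\<dots> = 0"
      using B.cond_exp_inner[OF f h(1) h'] B.cond_exp_inner[OF f h(1), of "Suc (n + k)"] h(2)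
      by simp
    finally show ?thesis .
  qed
qed

lemma sum_cond_exp_diff:
  "(\<Sum>m<N. cond_exp_diff M B m f x) = real_cond_exp M (B 0) f x - real_cond_exp M (B N) f x"
  unfolding cond_exp_diff_def by (rule sum_lessThan_telescope')

lemma cond_exp_diff_square_summable:
  assumes f: "f \<in> L2_space M"
  shows "summable (\<lambda>m. (L2_norm M (cond_exp_diff M B m f))\<^sup>2)"
proof (rule summableI_nonneg_bounded)
  interpret mds: reverse_mds M B "\<lambda>m. cond_exp_diff M B m f"
    using reverse_mds_cond_exp_diff[of "\<lambda>_. f" 0] f by simp
  show "(\<Sum>m<N. (L2_norm M (cond_exp_diff M B m f))\<^sup>2) \<le> (2 * L2_norm M f)\<^sup>2" for N
  proof -
    have "L2_norm M (\<lambda>x. \<Sum>m<N. cond_exp_diff M B m f x) \<le>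
        L2_norm M (real_cond_exp M (B 0) f) + L2_norm M (\<lambda>x. - real_cond_exp M (B N) f x)"
      unfolding sum_cond_exp_diff
      using L2_norm_triangle[OF B.cond_exp_L2[OF f, of 0] L2_uminus[OF B.cond_exp_L2[OF f, of N]]]
      by simp
    also have "\<dots> \<le> 2 * L2_norm M f"
      unfolding L2_norm_uminus
      using B.cond_exp_norm_le[OF f, of 0] B.cond_exp_norm_le[OF f, of N] by linarith
    finally have "(L2_norm M (\<lambda>x. \<Sum>m<N. cond_exp_diff M B m f x))\<^sup>2 \<le> (2 * L2_norm M f)\<^sup>2"
      by (rule power_mono) (rule L2_norm_nonneg)
    then show ?thesis
      by (simp only: mds.Pythagoras)
  qed
qed simp

text \<open>Reverse martingale convergence in the form needed here. The conditional expectations converge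
almost everywhere, as their differences are summable. The limit \<open>g\<close> is measurable with respect to
every \<open>B n\<close>, hence to the tail algebra, and it has to be 0 because \<open>f\<close> is orthogonal to all such
functions.\<close>

lemma sums_cond_exp_diff:
  assumes f: "f \<in> L2_space M"
    and tail: "AE x in M. real_cond_exp M (tail_algebra M B) f x = 0"
  shows "AE x in M. (\<lambda>m. cond_exp_diff M B m f x) sums f x"
proof -
  interpret mds: reverse_mds M B "\<lambda>m. cond_exp_diff M B m f"
    using reverse_mds_cond_exp_diff[of "\<lambda>_. f" 0] f by simp
  interpret T: finite_measure_subalgebra M "tail_algebra M B"
    by unfold_locales (rule subalgebra_tail_algebra[OF subalgebra])
  note sq = cond_exp_diff_square_summable[OF f]
  define E where "E n = real_cond_exp M (B n) f" for n
  have E_L2: "E n \<in> L2_space M" for n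
    unfolding E_def by (rule B.cond_exp_L2[OF f])
  define g where "g x = lim (\<lambda>n. E n x)" for x
  (* Dropping the first m terms does not change the limit. The value that lim takes on divergent
     sequences depends only on the set of limits, so this holds at every point. *)
  have g_B: "g \<in> borel_measurable (B m)" for m
  proof -
    have "lim (\<lambda>n. E n x) = lim (\<lambda>n. E (n + m) x)" for x
    proof -
      have "(\<lambda>n. E n x) \<longlonglongrightarrow> l \<longleftrightarrow> (\<lambda>n. E (n + m) x) \<longlonglongrightarrow> l" for l
        by (rule iffI) (rule LIMSEQ_ignore_initial_segment LIMSEQ_offset, assumption)+
      then show ?thesis
        by (simp add: lim_def)
    qed
    moreover have "(\<lambda>x. lim (\<lambda>n. E (n + m) x)) \<in> borel_measurable (B m)"
      unfolding E_def
      by (rule borel_measurable_lim_metric, rule measurable_antimono[OF le_add2 borel_measurable_cond_exp])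
    ultimately show ?thesis
      by (simp add: g_def[abs_def])
  qed
  have g_T: "g \<in> borel_measurable (tail_algebra M B)"
    using g_B by (rule measurable_tail_algebra)
  have E_lim: "AE x in M. (\<lambda>n. E n x) \<longlonglongrightarrow> g x"
    using mds.AE_summable[OF sq]
  proof eventually_elim
    case (elim x)
    then have "(\<lambda>N. E 0 x - (\<Sum>m<N. cond_exp_diff M B m f x)) \<longlonglongrightarrow>
        E 0 x - (\<Sum>m. cond_exp_diff M B m f x)"
      by (intro tendsto_diff tendsto_const summable_LIMSEQ)
    then have "convergent (\<lambda>n. E n x)"
      by (auto simp: sum_cond_exp_diff E_def[symmetric] convergent_def)
    then show ?case
      by (simp add: g_def convergent_LIMSEQ_iff)
  qed
  have g_M: "g \<in> borel_measurable M"
    by (rule measurable_from_subalg[OF subalgebra g_B])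
  have g_L2: "g \<in> L2_space M"
    using E_L2 g_M E_lim by (rule L2_Fatou(1)) (unfold E_def, rule B.cond_exp_norm_le[OF f])
  (* g is orthogonal to f, hence to every E n, so its distance to E n is at least its norm;
     but that distance tends to 0. *)
  have g_f: "(\<integral>x. g x * f x \<partial>M) = 0"
  proof -
    have "(\<integral>x. g x * f x \<partial>M) = (\<integral>x. g x * real_cond_exp M (tail_algebra M B) f x \<partial>M)"
      by (rule T.cond_exp_inner[OF f g_L2 g_T, symmetric])
    also have "\<dots> = (\<integral>x. 0 \<partial>M)"
      using tail g_M by (intro integral_cong_AE borel_measurable_times T.cond_exp_measurable_M) auto
    finally show ?thesis by simp
  qed
  have g_E: "(\<integral>x. g x * E n x \<partial>M) = 0" for n
    unfolding E_def using B.cond_exp_inner[OF f g_L2 g_B] g_f by simp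
  have dist: "(L2_norm M g)\<^sup>2 \<le> L2_norm M g * sqrt (\<Sum>m. (L2_norm M (cond_exp_diff M B (m + n) f))\<^sup>2)" for n
  proof -
    interpret sh: reverse_mds M "\<lambda>m. B (m + n)" "\<lambda>m. cond_exp_diff M B (m + n) f"
      using reverse_mds_cond_exp_diff[of "\<lambda>_. f" n] f by simp
    have sq': "summable (\<lambda>m. (L2_norm M (cond_exp_diff M B (m + n) f))\<^sup>2)"
      by (rule summable_ignore_initial_segment[OF sq])
    have eq: "AE x in M. (\<Sum>m. cond_exp_diff M B (m + n) f x) = E n x - g x"
      using mds.AE_summable[OF sq] E_lim
    proof eventually_elim
      case (elim x)
      have "(\<lambda>N. E 0 x - E N x) \<longlonglongrightarrow> (\<Sum>m. cond_exp_diff M B m f x)"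
        using summable_LIMSEQ[OF elim(1)] by (simp add: sum_cond_exp_diff E_def)
      moreover have "(\<lambda>N. E 0 x - E N x) \<longlonglongrightarrow> E 0 x - g x"
        by (intro tendsto_diff tendsto_const elim)
      ultimately have "(\<Sum>m. cond_exp_diff M B m f x) = E 0 x - g x"
        by (rule LIMSEQ_unique)
      then show ?case
        using suminf_minus_initial_segment[OF elim(1), of n]
        by (simp add: sum_cond_exp_diff E_def)
    qed
    have "(L2_norm M g)\<^sup>2 = (\<integral>x. g x * g x \<partial>M) - (\<integral>x. g x * E n x \<partial>M)"
      unfolding L2_norm_square g_E by (simp add: power2_eq_square)
    also have "\<dots> = (\<integral>x. g x * - (E n x - g x) \<partial>M)"
      using L2_mult_integrable[OF g_L2 g_L2] L2_mult_integrable[OF g_L2 E_L2[of n]]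
      by (simp add: right_diff_distrib)
    also have "\<dots> \<le> L2_norm M g * L2_norm M (\<lambda>x. - (E n x - g x))"
      by (intro L2_Cauchy_Schwarz g_L2 L2_uminus L2_diff E_L2)
    also have "L2_norm M (\<lambda>x. - (E n x - g x)) = L2_norm M (\<lambda>x. \<Sum>m. cond_exp_diff M B (m + n) f x)"
      using L2_cong_AE(2)[OF sh.sum_L2(1)[OF sq'] L2_spaceD(1)[OF L2_diff[OF E_L2 g_L2]] eq]
      by (simp only: L2_norm_uminus)
    also have "L2_norm M g * \<dots> \<le>
        L2_norm M g * sqrt (\<Sum>m. (L2_norm M (cond_exp_diff M B (m + n) f))\<^sup>2)"
      by (intro mult_left_mono sh.sum_L2 sq' L2_norm_nonneg)
    finally show ?thesis .
  qed
  have "(\<lambda>n. \<Sum>m. (L2_norm M (cond_exp_diff M B (m + n) f))\<^sup>2) \<longlonglongrightarrow> 0"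
    using suminf_exist_split2[OF sq] by simp
  then have "(\<lambda>n. L2_norm M g * sqrt (\<Sum>m. (L2_norm M (cond_exp_diff M B (m + n) f))\<^sup>2))
      \<longlonglongrightarrow> L2_norm M g * sqrt 0"
    by (intro tendsto_mult tendsto_const tendsto_real_sqrt)
  then have "(L2_norm M g)\<^sup>2 \<le> L2_norm M g * sqrt 0"
    by (rule LIMSEQ_le_const) (use dist in blast)
  then have "(L2_norm M g)\<^sup>2 = 0"
    by simp
  then have "(\<integral>x. (g x)\<^sup>2 \<partial>M) = 0"
    by (simp only: L2_norm_square)
  then have g0: "AE x in M. g x = 0"
    using L2_spaceD(2)[OF g_L2] by (simp add: integral_nonneg_eq_0_iff_AE)
  have E0: "AE x in M. E 0 x = f x"
    unfolding E_def
  proof (rule B.real_cond_exp_F_meas)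
    show "integrable M f" by (rule L1_le_L2_norm[OF f])
    show "f \<in> borel_measurable (B 0)"
      using L2_spaceD(1)[OF f] total measurable_cong_sets by blast
  qed
  show ?thesis
    using E_lim g0 E0
  proof eventually_elim
    case (elim x)
    then have "(\<lambda>N. E 0 x - E N x) \<longlonglongrightarrow> f x - 0"
      by (intro tendsto_diff) auto
    then show ?case
      by (simp add: sums_def sum_cond_exp_diff E_def)
  qed
qed

end

section \<open>Convergence of the series\<close>

lemma sum_lower_triangle:
  fixes a :: "nat \<Rightarrow> nat \<Rightarrow> 'b :: comm_monoid_add"
  shows "(\<Sum>j<N. \<Sum>m<j. a m j) = (\<Sum>k<N. \<Sum>n<N - Suc k. a n (n + Suc k))"
proof (induction N)
  case (Suc N)
  have "(\<Sum>k<Suc N. \<Sum>n<Suc N - Suc k. a n (n + Suc k)) =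
      (\<Sum>k<N. \<Sum>n<Suc (N - Suc k). a n (n + Suc k))"
    by (auto intro!: sum.cong simp: Suc_diff_Suc)
  also have "\<dots> = (\<Sum>k<N. \<Sum>n<N - Suc k. a n (n + Suc k)) + (\<Sum>k<N. a (N - Suc k) N)"
    by (simp add: sum.distrib)
  also have "(\<Sum>k<N. a (N - Suc k) N) = (\<Sum>m<N. a m N)"
    by (rule sum.nat_diff_reindex)
  finally show ?case
    using Suc by simp
qed simp

text \<open>Summation along diagonals, on which the entries will be reverse martingale differences. On the
side where \<open>m\<close> is at least \<open>j\<close> every diagonal contributes \<open>N\<close> entries. On the other side the
diagonal \<open>m + Suc k = j\<close> starts late and contributes \<open>N - Suc k\<close> entries, which is 0 for large \<open>k\<close>.\<close>

lemma sum_rearrange: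
  fixes a :: "nat \<Rightarrow> nat \<Rightarrow> real"
  assumes "\<And>j. (\<lambda>m. a m j) sums z j"
  shows "(\<Sum>j<N. z j) = (\<Sum>k. \<Sum>n<N. a (n + k) n) + (\<Sum>k. \<Sum>n<N - Suc k. a n (n + Suc k))"
proof -
  have "z j = (\<Sum>k. a (j + k) j) + (\<Sum>m<j. a m j)" for j
    using suminf_split_initial_segment[OF sums_summable[OF assms], of j j] sums_unique[OF assms, of j]
    by (simp add: add.commute)
  then have "(\<Sum>j<N. z j) = (\<Sum>j<N. \<Sum>k. a (j + k) j) + (\<Sum>j<N. \<Sum>m<j. a m j)"
    by (simp add: sum.distrib)
  also have "(\<Sum>j<N. \<Sum>k. a (j + k) j) = (\<Sum>k. \<Sum>j<N. a (j + k) j)"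
  proof (rule suminf_sum[symmetric])
    show "summable (\<lambda>k. a (j + k) j)" for j
      using summable_ignore_initial_segment[OF sums_summable[OF assms], of j j]
      by (simp add: add.commute)
  qed
  also have "(\<Sum>j<N. \<Sum>m<j. a m j) = (\<Sum>k. \<Sum>n<N - Suc k. a n (n + Suc k))"
    unfolding sum_lower_triangle by (rule suminf_finite[symmetric]) auto
  finally show ?thesis .
qed

theorem theoremB:
  fixes M :: "'a measure" and B :: "nat \<Rightarrow> 'a measure" and Z :: "nat \<Rightarrow> 'a \<Rightarrow> real"
  assumes "prob_space M"
    and "\<And>n. subalgebra M (B n)"
    and "decseq (\<lambda>n. sets (B n))"
    and "sets (B 0) = sets M"
    and "\<And>n. Z n \<in> L2_space M"
    and "\<And>n. AE x in M. real_cond_exp M (tail_algebra M B) (Z n) x = 0"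
    and "\<And>k. summable (\<lambda>n. (L2_norm M (cond_exp_diff M B (n + k) (Z n)))\<^sup>2)"
    and "summable (\<lambda>k. sqrt (\<Sum>n. (L2_norm M (cond_exp_diff M B (n + k) (Z n)))\<^sup>2))"
    and "\<And>k. k \<ge> 1 \<Longrightarrow> summable (\<lambda>n. (L2_norm M (cond_exp_diff M B n (Z (n + k))))\<^sup>2)"
    and "summable (\<lambda>k. sqrt (\<Sum>n. (L2_norm M (cond_exp_diff M B n (Z (n + Suc k))))\<^sup>2))"
  shows "(AE x in M. summable (\<lambda>n. Z n x)) \<and>
    (\<exists>S \<in> L2_space M. (\<lambda>N. L2_norm M (\<lambda>x. (\<Sum>n<N. Z n x) - S x)) \<longlonglongrightarrow> 0)"
proof -
  interpret reverse_filtration M B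
    using assms(1-4) by (simp add: reverse_filtration_def reverse_filtration_axioms_def)
  note Z = assms(5)
  define U where "U k n = cond_exp_diff M B (n + k) (Z n)" for k n
  define V where "V k n = cond_exp_diff M B n (Z (n + Suc k))" for k n
  interpret U: reverse_mds_family M "\<lambda>k n. B (n + k)" U
  proof (rule reverse_mds_family.intro)
    show "reverse_mds M (\<lambda>n. B (n + k)) (U k)" for k
      unfolding U_def by (rule reverse_mds_cond_exp_diff[OF Z])
  qed (use assms(7,8) in \<open>auto simp: U_def\<close>)
  interpret V: reverse_mds_family M "\<lambda>k. B" V
  proof (rule reverse_mds_family.intro)
    show "reverse_mds M B (V k)" for k
      unfolding V_def
      using reverse_mds_cond_exp_diff[of "\<lambda>n. Z (n + Suc k)" 0] Z by simp
  qed (use assms(9)[of "Suc _"] assms(10) in \<open>auto simp: V_def\<close>)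
  define S where "S x = (\<Sum>k. \<Sum>n. U k n x) + (\<Sum>k. \<Sum>n. V k n x)" for x
  (* The diagonals of U start at once and those of V with delay Suc k. *)
  define RU where "RU N x = (\<Sum>k. \<Sum>n. U k n x) - (\<Sum>k. \<Sum>n<N - 0. U k n x)" for N x
  define RV where "RV N x = (\<Sum>k. \<Sum>n. V k n x) - (\<Sum>k. \<Sum>n<N - Suc k. V k n x)" for N x
  note RU = U.double_sum_remainder[where c = "\<lambda>_. 0", folded RU_def]
  note RV = V.double_sum_remainder[where c = Suc, folded RV_def]
  have S: "S \<in> L2_space M"
    unfolding S_def by (intro L2_add U.double_sum_L2 V.double_sum_L2)
  have "AE x in M. \<forall>j. (\<lambda>m. cond_exp_diff M B m (Z j) x) sums Z j x"
    unfolding AE_all_countable using sums_cond_exp_diff[OF Z assms(6)] by blast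
  then have partial: "AE x in M. \<forall>N. (\<Sum>j<N. Z j x) =
      (\<Sum>k. \<Sum>n<N - 0. U k n x) + (\<Sum>k. \<Sum>n<N - Suc k. V k n x)"
  proof eventually_elim
    case (elim x)
    then show ?case
      using sum_rearrange[of "\<lambda>m j. cond_exp_diff M B m (Z j) x" "\<lambda>j. Z j x"]
      by (simp add: U_def V_def)
  qed
  have "AE x in M. summable (\<lambda>n. Z n x)"
    using partial U.double_sum_AE[of "\<lambda>_. 0"] V.double_sum_AE[of Suc]
  proof eventually_elim
    case (elim x)
    then have "(\<lambda>N. \<Sum>j<N. Z j x) \<longlonglongrightarrow> S x"
      unfolding S_def by (auto intro: tendsto_add)
    then show ?case
      by (auto simp: summable_def sums_def)
  qed
  moreover have "(\<lambda>N. L2_norm M (\<lambda>x. (\<Sum>n<N. Z n x) - S x)) \<longlonglongrightarrow> 0"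
  proof (rule tendsto_sandwich[OF _ _ tendsto_const])
    have "L2_norm M (\<lambda>x. (\<Sum>n<N. Z n x) - S x) \<le> L2_norm M (RU N) + L2_norm M (RV N)" for N
    proof -
      have eq: "AE x in M. - (RU N x + RV N x) = (\<Sum>n<N. Z n x) - S x"
        using partial by eventually_elim (simp add: RU_def RV_def S_def)
      have "L2_norm M (\<lambda>x. (\<Sum>n<N. Z n x) - S x) = L2_norm M (\<lambda>x. - (RU N x + RV N x))"
        by (intro L2_cong_AE(2)[OF _ _ eq] L2_uminus L2_add RU RV L2_spaceD(1)[OF L2_diff] L2_sum Z S)
      then show ?thesis
        using L2_norm_triangle[OF RU(1) RV(1)] by (simp only: L2_norm_uminus)
    qed
    then show "\<forall>\<^sub>F N in sequentially.
        L2_norm M (\<lambda>x. (\<Sum>n<N. Z n x) - S x) \<le> L2_norm M (RU N) + L2_norm M (RV N)"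
      by simp
    show "(\<lambda>N. L2_norm M (RU N) + L2_norm M (RV N)) \<longlonglongrightarrow> 0"
      using tendsto_add[OF RU(2) RV(2)] by simp
  qed (simp add: L2_norm_nonneg)
  ultimately show ?thesis
    using S by blast
qed

end
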